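(* Let $\Gamma$ be a sub lattice of Young's lattice $YL$ such that for any $\lambda\in\Gamma$ and $\mu<\lambda$ one has $\mu\in\Gamma$. Then any automorphism of the graph $\Gamma$ fixing $\emptyset$ is either the identity or the reflection of Young diagrams by the diagonal. Consequently, for $N\in\mathbb{N}^+$, $\mathrm{Aut}(YL(N))=D_{2(N+1)}$.
   Context: Young's lattice $YL$ is the graph whose vertices are all Young diagrams; $\mu<\lambda$ means that $\lambda$ is obtained from $\mu$ by adding one cell, and there is an edge between $\mu$ and $\lambda$ exactly when $\mu<\lambda$ or $\lambda<\mu$. A sub lattice $\Gamma$ is regarded as the full subgraph on its set of vertices. The reflection by the diagonal sends a Young diagram to its transpose. $YL(N)$ is the full subgraph of $YL$ on the Young diagrams whose $(1,1)$ cell has hook length at most $N$ (together with $\emptyset$). $\mathrm{Aut}(YL(N))$ is the automorphism group of the graph $YL(N)$, and $D_{2(N+1)}$ is the dihedral group of order $2(N+1)$.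
   Formalization: The claim Aut(YL(N)) = D_{2(N+1)} is proved for N ≥ 2 only; at N = 1 it is false, since YL(1) is a single edge whose automorphism group has order 2, while the dihedral group there has order 4. *)

theory Defs
  imports "HOL-Algebra.Bij" "HOL-Algebra.Coset"
begin

section \<open>Young diagrams and Young's lattice\<close>

text \<open>A Young diagram is a finite set of cells \<open>(i, j)\<close> (row \<open>i\<close>, column \<open>j\<close>, both counted
  from 1) that contains every cell weakly to the left of and weakly above any of its cells.\<close>

definition young_diagrams :: "(nat \<times> nat) set set" where
  "young_diagrams =
    {\<mu>. finite \<mu> \<and> \<mu> \<subseteq> {1..} \<times> {1..} \<and>
        (\<forall>i j i' j'. (i, j) \<in> \<mu> \<and> 1 \<le> i' \<and> i' \<le> i \<and> 1 \<le> j' \<and> j' \<le> j \<longrightarrow> (i', j') \<in> \<mu>)}"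

definition young_less :: "(nat \<times> nat) set \<Rightarrow> (nat \<times> nat) set \<Rightarrow> bool" where
  "young_less \<mu> \<nu> \<longleftrightarrow>
    \<mu> \<in> young_diagrams \<and> \<nu> \<in> young_diagrams \<and> (\<exists>c. c \<notin> \<mu> \<and> \<nu> = insert c \<mu>)"

definition young_adj :: "(nat \<times> nat) set \<Rightarrow> (nat \<times> nat) set \<Rightarrow> bool" where
  "young_adj \<mu> \<nu> \<longleftrightarrow> young_less \<mu> \<nu> \<or> young_less \<nu> \<mu>"

definition reflect :: "(nat \<times> nat) set \<Rightarrow> (nat \<times> nat) set" where
  "reflect \<mu> = prod.swap ` \<mu>"

text \<open>The arm, the leg, and the cell \<open>(i, j)\<close> itself.\<close>

definition hook_length :: "(nat \<times> nat) set \<Rightarrow> nat \<times> nat \<Rightarrow> nat" where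
  "hook_length \<mu> = (\<lambda>(i, j). card {j'. j < j' \<and> (i, j') \<in> \<mu>} + card {i'. i < i' \<and> (i', j) \<in> \<mu>} + 1)"

definition YL :: "nat \<Rightarrow> (nat \<times> nat) set set" where
  "YL N = {\<mu> \<in> young_diagrams. \<mu> = {} \<or> hook_length \<mu> (1, 1) \<le> N}"


section \<open>Automorphism groups of graphs\<close>

text \<open>The automorphisms of the full subgraph on the vertex set \<open>V\<close> of a graph with adjacency
  relation \<open>adj\<close>. As in \<^const>\<open>Bij\<close>, maps are normalised to be \<^const>\<open>undefined\<close> outside \<open>V\<close>,
  so that equal automorphisms are equal functions.\<close>

definition graph_automorphisms :: "'a set \<Rightarrow> ('a \<Rightarrow> 'a \<Rightarrow> bool) \<Rightarrow> ('a \<Rightarrow> 'a) set" where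
  "graph_automorphisms V adj =
    {\<phi> \<in> Bij V. \<forall>x\<in>V. \<forall>y\<in>V. adj (\<phi> x) (\<phi> y) \<longleftrightarrow> adj x y}"

definition Aut_graph :: "'a set \<Rightarrow> ('a \<Rightarrow> 'a \<Rightarrow> bool) \<Rightarrow> ('a \<Rightarrow> 'a) monoid" where
  "Aut_graph V adj = (BijGroup V)\<lparr>carrier := graph_automorphisms V adj\<rparr>"

lemma group_Aut_graph: "group (Aut_graph V adj)"
proof -
  interpret B: group "BijGroup V" by (rule group_BijGroup)
  have "subgroup (graph_automorphisms V adj) (BijGroup V)"
  proof (rule B.subgroupI)
    show "graph_automorphisms V adj \<subseteq> carrier (BijGroup V)"
      by (auto simp: graph_automorphisms_def BijGroup_def)
    show "graph_automorphisms V adj \<noteq> {}"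
      using id_Bij[of V] by (force simp: graph_automorphisms_def)
  next
    fix f assume f: "f \<in> graph_automorphisms V adj"
    then have fB: "f \<in> Bij V" and adj: "\<And>x y. x \<in> V \<Longrightarrow> y \<in> V \<Longrightarrow> adj (f x) (f y) \<longleftrightarrow> adj x y"
      by (auto simp: graph_automorphisms_def)
    from fB have bij: "bij_betw f V V" by (simp add: Bij_def)
    define g where "g = restrict (inv_into V f) V"
    have gB: "g \<in> Bij V" unfolding g_def by (rule restrict_inv_into_Bij[OF fB])
    have gV: "g x \<in> V" if "x \<in> V" for x
      using that bij by (auto simp: g_def bij_betw_def intro: inv_into_into)
    have fg: "f (g x) = x" if "x \<in> V" for x
      using that bij by (auto simp: g_def bij_betw_def f_inv_into_f)
    have "adj (g x) (g y) \<longleftrightarrow> adj x y" if "x \<in> V" "y \<in> V" for x y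
      using adj[OF gV gV, of x y] fg that by simp
    with gB have "g \<in> graph_automorphisms V adj" by (simp add: graph_automorphisms_def)
    then show "inv\<^bsub>BijGroup V\<^esub> f \<in> graph_automorphisms V adj"
      using inv_BijGroup[OF fB] by (simp add: g_def restrict_def)
  next
    fix f g assume "f \<in> graph_automorphisms V adj" "g \<in> graph_automorphisms V adj"
    then show "f \<otimes>\<^bsub>BijGroup V\<^esub> g \<in> graph_automorphisms V adj"
      using compose_Bij[of f V g] Bij_imp_funcset[of g V]
      by (auto simp: graph_automorphisms_def BijGroup_def compose_eq Pi_iff)
  qed
  then show ?thesis unfolding Aut_graph_def by (rule subgroup.subgroup_is_group) (rule B.is_group)
qed


section \<open>Dihedral groups\<close>

text \<open>The dihedral group of order \<open>2 * n\<close>: the pair \<open>(a, s)\<close> stands for the rotation \<open>r\<^sup>a\<close> if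
  \<open>s\<close> is false and for \<open>r\<^sup>a f\<close> otherwise, where \<open>r\<close> has order \<open>n\<close> and \<open>f\<close> is an involution
  with \<open>f r = r\<^sup>-\<^sup>1 f\<close>.\<close>

definition dihedral_group :: "nat \<Rightarrow> (int \<times> bool) monoid" where
  "dihedral_group n =
    \<lparr>carrier = {0..<int n} \<times> UNIV,
     mult = (\<lambda>(a, s) (b, t). ((if s then a - b else a + b) mod int n, s \<noteq> t)),
     one = (0, False)\<rparr>"

lemma order_dihedral_group: "order (dihedral_group n) = 2 * n"
  by (simp add: order_def dihedral_group_def)

lemma group_dihedral_group:
  assumes "n \<ge> 1"
  shows "group (dihedral_group n)"
proof (rule groupI)
  fix x assume "x \<in> carrier (dihedral_group n)"
  then obtain a s where x: "x = (a, s)" "0 \<le> a" "a < int n"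
    by (auto simp: dihedral_group_def)
  have "(if s then x else ((- a) mod int n, False)) \<in> carrier (dihedral_group n)"
    using x assms by (auto simp: dihedral_group_def)
  moreover have "(if s then x else ((- a) mod int n, False)) \<otimes>\<^bsub>dihedral_group n\<^esub> x = \<one>\<^bsub>dihedral_group n\<^esub>"
    using x by (auto simp: dihedral_group_def mod_simps)
  ultimately show "\<exists>y\<in>carrier (dihedral_group n). y \<otimes>\<^bsub>dihedral_group n\<^esub> x = \<one>\<^bsub>dihedral_group n\<^esub>"
    by blast
next
  fix x y z
  show "x \<otimes>\<^bsub>dihedral_group n\<^esub> y \<otimes>\<^bsub>dihedral_group n\<^esub> z
      = x \<otimes>\<^bsub>dihedral_group n\<^esub> (y \<otimes>\<^bsub>dihedral_group n\<^esub> z)"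
    by (cases x; cases y; cases z; cases "snd x"; cases "snd y"; cases "snd z")
      (simp_all add: dihedral_group_def mod_simps add.assoc diff_diff_eq diff_diff_eq2 add_diff_eq diff_add_eq)
qed (use assms in \<open>auto simp: dihedral_group_def\<close>)

text \<open>\<^term>\<open>YL 1\<close> is a single edge, so its automorphism group has order 2 and is not the dihedral
  group of order 4. This is why \<^prop>\<open>N \<ge> 2\<close> is needed for \<^term>\<open>Aut_graph (YL N) young_adj\<close> to
  be the dihedral group of order \<open>2 * (N + 1)\<close>.\<close>

lemma YL_1: "YL 1 = {{}, {(1, 1)}}"
proof (intro equalityI subsetI)
  fix \<mu> assume "\<mu> \<in> YL 1"
  then have \<mu>: "\<mu> \<in> young_diagrams" and h: "\<mu> = {} \<or> hook_length \<mu> (1, 1) \<le> 1"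
    by (auto simp: YL_def)
  show "\<mu> \<in> {{}, {(1, 1)}}"
  proof (cases "\<mu> = {}")
    case False
    have fin: "finite \<mu>" and pos: "\<And>i j. (i, j) \<in> \<mu> \<Longrightarrow> 1 \<le> i \<and> 1 \<le> j"
      and down: "\<And>i j i' j'. (i, j) \<in> \<mu> \<Longrightarrow> 1 \<le> i' \<Longrightarrow> i' \<le> i \<Longrightarrow> 1 \<le> j' \<Longrightarrow> j' \<le> j \<Longrightarrow> (i', j') \<in> \<mu>"
      using \<mu> unfolding young_diagrams_def by blast+
    have "finite {j'. 1 < j' \<and> (1, j') \<in> \<mu>}"
      by (rule finite_subset[OF _ finite_imageI[OF fin, of snd]]) force
    moreover have "finite {i'. 1 < i' \<and> (i', 1) \<in> \<mu>}"
      by (rule finite_subset[OF _ finite_imageI[OF fin, of fst]]) force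
    ultimately have "{j'. 1 < j' \<and> (1, j') \<in> \<mu>} = {}" "{i'. 1 < i' \<and> (i', 1) \<in> \<mu>} = {}"
      using h False by (auto simp: hook_length_def)
    then have arm: "\<And>j. (1, j) \<in> \<mu> \<Longrightarrow> \<not> 1 < j" and leg: "\<And>i. (i, 1) \<in> \<mu> \<Longrightarrow> \<not> 1 < i"
      by blast+
    have eq: "i = 1 \<and> j = 1" if "(i, j) \<in> \<mu>" for i j
    proof -
      have "(1, j) \<in> \<mu>" "(i, 1) \<in> \<mu>" using down[OF that] pos[OF that] by auto
      then show ?thesis using arm leg pos[OF that] by force
    qed
    with False have "\<mu> = {(1, 1)}" by force
    then show ?thesis by simp
  qed simp
next
  fix \<mu> :: "(nat \<times> nat) set" assume "\<mu> \<in> {{}, {(1, 1)}}"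
  then show "\<mu> \<in> YL 1" by (auto simp: YL_def young_diagrams_def hook_length_def)
qed

lemma not_iso_YL_1: "\<not> Aut_graph (YL 1) young_adj \<cong> dihedral_group (1 + 1)"
proof
  define V where "V = YL 1"
  obtain a b where V: "V = {a, b}" and ab: "a \<noteq> b"
    using YL_1 unfolding V_def by blast
  let ?A = "carrier (Aut_graph V young_adj)"
  assume "Aut_graph (YL 1) young_adj \<cong> dihedral_group (1 + 1)"
  then have "card ?A = card (carrier (dihedral_group (1 + 1)))"
    unfolding V_def by (rule iso_same_card)
  also have "\<dots> = 4" by (simp add: dihedral_group_def)
  finally have four: "card ?A = 4" .
  have bij: "bij_betw f V V" and ext: "f \<in> extensional V" if "f \<in> ?A" for f
    using that by (simp_all add: Aut_graph_def graph_automorphisms_def Bij_def)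
  have img: "f a \<in> V" "f b \<in> V" "f a \<noteq> f b" if "f \<in> ?A" for f
    using bij[OF that] V ab by (auto simp: bij_betw_def inj_on_def)
  have inj: "inj_on (\<lambda>f. f a) ?A"
  proof (rule inj_onI)
    fix f g assume fg: "f \<in> ?A" "g \<in> ?A" and a: "f a = g a"
    have b: "f b = g b"
      using img[OF fg(1)] img[OF fg(2)] a unfolding V by (metis insertE singletonD)
    show "f = g"
    proof (rule extensionalityI[OF ext[OF fg(1)] ext[OF fg(2)]])
      fix x assume "x \<in> V"
      then show "f x = g x" using a b V by blast
    qed
  qed
  have "(\<lambda>f. f a) ` ?A \<subseteq> V" using img(1) by blast
  from card_inj_on_le[OF inj this] have "card ?A \<le> card V" by (simp add: V)
  also have "\<dots> = 2" using ab by (simp add: V)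
  finally show False using four by linarith
qed

end

(* In an order ideal of Young's lattice the distance from the empty diagram is the number of cells, so
   an automorphism fixing the empty diagram preserves sizes and covers. A diagram with at least three
   cells is determined by the diagrams it covers, so the automorphism is determined by its action on
   the two diagrams with two cells.

   YL N has a further symmetry r, found by Suter: delete the first row, of length l, and put a new
   column of length N - l in front. If f is the reflection then (f r)^2 = 1, and r moves the empty
   diagram through the rectangles of N + 1 - k rows and k columns. These rectangles, with the empty
   diagram, are the only vertices with at most one neighbour, so r acts transitively on the possible
   images of the empty diagram. The stabiliser of the empty diagram is {1, f}; it contains r^(N+1),
   which is not f, since r would then commute with f and be an involution. *)
theory Submission
  imports Defs
begin


section \<open>Young diagrams, covers and reflection\<close>

lemma young_diagramsI:
  assumes "finite \<mu>" and "\<And>i j. (i, j) \<in> \<mu> \<Longrightarrow> 1 \<le> i \<and> 1 \<le> j"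
    and "\<And>i j i' j'. (i, j) \<in> \<mu> \<Longrightarrow> 1 \<le> i' \<Longrightarrow> i' \<le> i \<Longrightarrow> 1 \<le> j' \<Longrightarrow> j' \<le> j \<Longrightarrow> (i', j') \<in> \<mu>"
  shows "\<mu> \<in> young_diagrams"
proof -
  have "\<mu> \<subseteq> {1..} \<times> {1..}" using assms(2) by auto
  then show ?thesis unfolding young_diagrams_def using assms(1,3) by blast
qed

lemma young_finite: "\<mu> \<in> young_diagrams \<Longrightarrow> finite \<mu>"
  by (simp add: young_diagrams_def)

lemma young_pos: "\<mu> \<in> young_diagrams \<Longrightarrow> (i, j) \<in> \<mu> \<Longrightarrow> 1 \<le> i \<and> 1 \<le> j"
  unfolding young_diagrams_def by blast

lemma young_down:
  "\<mu> \<in> young_diagrams \<Longrightarrow> (i, j) \<in> \<mu> \<Longrightarrow> 1 \<le> i' \<Longrightarrow> i' \<le> i \<Longrightarrow> 1 \<le> j' \<Longrightarrow> j' \<le> j \<Longrightarrow> (i', j') \<in> \<mu>"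
  unfolding young_diagrams_def by blast

lemma young_empty: "{} \<in> young_diagrams"
  by (simp add: young_diagrams_def)

lemma young_one_one: "\<mu> \<in> young_diagrams \<Longrightarrow> \<mu> \<noteq> {} \<Longrightarrow> (1, 1) \<in> \<mu>"
proof -
  assume Y: "\<mu> \<in> young_diagrams" and "\<mu> \<noteq> {}"
  then obtain i j where ij: "(i, j) \<in> \<mu>" by auto
  show "(1, 1) \<in> \<mu>" using young_down[OF Y ij, of 1 1] young_pos[OF Y ij] by simp
qed

lemma reflect_iff [simp]: "(i, j) \<in> reflect \<mu> \<longleftrightarrow> (j, i) \<in> \<mu>"
  unfolding reflect_def by force

lemma reflect_reflect [simp]: "reflect (reflect \<mu>) = \<mu>"
  by auto

lemma reflect_empty [simp]: "reflect {} = {}"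
  by (simp add: reflect_def)

lemma reflect_insert: "reflect (insert c \<mu>) = insert (prod.swap c) (reflect \<mu>)"
  by (simp add: reflect_def)

lemma young_reflect:
  assumes "\<mu> \<in> young_diagrams"
  shows "reflect \<mu> \<in> young_diagrams"
proof (rule young_diagramsI)
  show "finite (reflect \<mu>)" using young_finite[OF assms] by (simp add: reflect_def)
next
  fix i j i' j'
  assume "(i, j) \<in> reflect \<mu>" "1 \<le> i'" "i' \<le> i" "1 \<le> j'" "j' \<le> j"
  then show "(i', j') \<in> reflect \<mu>" using young_down[OF assms, of j i j' i'] by simp
qed (use young_pos[OF assms] in simp)

lemma young_less_reflect: "young_less \<mu> \<nu> \<Longrightarrow> young_less (reflect \<mu>) (reflect \<nu>)"
proof -
  assume less: "young_less \<mu> \<nu>"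
  then obtain i j where c: "(i, j) \<notin> \<mu>" "\<nu> = insert (i, j) \<mu>" unfolding young_less_def by auto
  then have "(j, i) \<notin> reflect \<mu>" "reflect \<nu> = insert (j, i) (reflect \<mu>)"
    by (simp_all add: reflect_insert)
  then show "young_less (reflect \<mu>) (reflect \<nu>)"
    using less young_reflect unfolding young_less_def by blast
qed

lemma young_adj_reflect: "young_adj \<mu> \<nu> \<Longrightarrow> young_adj (reflect \<mu>) (reflect \<nu>)"
  unfolding young_adj_def using young_less_reflect by blast

lemma young_less_card: "young_less \<mu> \<nu> \<Longrightarrow> card \<nu> = Suc (card \<mu>)"
  unfolding young_less_def using young_finite by auto

text \<open>Sizes recover the direction of an edge, so an automorphism that preserves sizes also
  preserves covers.\<close>

lemma young_less_iff_adj: "young_less \<mu> \<nu> \<longleftrightarrow> young_adj \<mu> \<nu> \<and> card \<mu> < card \<nu>"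
proof -
  have "card \<mu> < card \<nu>" if "young_less \<mu> \<nu>" for \<mu> \<nu> using young_less_card[OF that] by simp
  then show ?thesis unfolding young_adj_def by (metis less_asym)
qed

lemma young_adj_sym: "young_adj \<mu> \<nu> \<longleftrightarrow> young_adj \<nu> \<mu>"
  unfolding young_adj_def by blast

section \<open>Corners, and diagrams with the same lower covers\<close>

lemma young_less_remove:
  assumes \<mu>: "\<mu> \<in> young_diagrams" and c: "(i, j) \<in> \<mu>"
    and top: "\<And>k l. (k, l) \<in> \<mu> \<Longrightarrow> i \<le> k \<Longrightarrow> j \<le> l \<Longrightarrow> (k, l) = (i, j)"
  shows "young_less (\<mu> - {(i, j)}) \<mu>"
proof -
  have "\<mu> - {(i, j)} \<in> young_diagrams"
  proof (rule young_diagramsI)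
    show "finite (\<mu> - {(i, j)})" using young_finite[OF \<mu>] by simp
  next
    fix k l k' l'
    assume kl: "(k, l) \<in> \<mu> - {(i, j)}" and le: "1 \<le> k'" "k' \<le> k" "1 \<le> l'" "l' \<le> l"
    have "(k', l') \<noteq> (i, j)" using top[of k l] kl le by auto
    then show "(k', l') \<in> \<mu> - {(i, j)}" using young_down[OF \<mu>, of k l k' l'] kl le by simp
  qed (use young_pos[OF \<mu>] in blast)
  then show ?thesis unfolding young_less_def using \<mu> c by blast
qed

text \<open>Among the cells weakly below and to the right of \<open>(i, j)\<close>, one with the
  largest coordinate sum has no other cell beyond it, so it can be removed.\<close>

lemma ex_corner:
  assumes \<mu>: "\<mu> \<in> young_diagrams" and c: "(i, j) \<in> \<mu>"
  obtains k l where "(k, l) \<in> \<mu>" "i \<le> k" "j \<le> l" "young_less (\<mu> - {(k, l)}) \<mu>"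
proof -
  let ?S = "{c \<in> \<mu>. i \<le> fst c \<and> j \<le> snd c}"
  have fin: "finite ?S" using young_finite[OF \<mu>] by simp
  moreover have "?S \<noteq> {}" using c by force
  ultimately have "Max ((\<lambda>c. fst c + snd c) ` ?S) \<in> (\<lambda>c. fst c + snd c) ` ?S"
    by (intro Max_in) auto
  then obtain d where "d \<in> ?S" "fst d + snd d = Max ((\<lambda>c. fst c + snd c) ` ?S)" by force
  then have d: "d \<in> ?S" "\<forall>e\<in>?S. fst e + snd e \<le> fst d + snd d" using fin by simp_all
  obtain k l where kl: "d = (k, l)" by fastforce
  have S: "(k, l) \<in> \<mu>" "i \<le> k" "j \<le> l" using d kl by auto
  have "(k', l') = (k, l)" if "(k', l') \<in> \<mu>" "k \<le> k'" "l \<le> l'" for k' l'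
  proof -
    have "(k', l') \<in> ?S" using that S by auto
    then have "k' + l' \<le> k + l" using d kl by fastforce
    then show ?thesis using that by auto
  qed
  then have "young_less (\<mu> - {(k, l)}) \<mu>" using young_less_remove[OF \<mu>] S by blast
  then show thesis using that S by blast
qed

lemma ex_lower_cover:
  assumes "\<mu> \<in> young_diagrams" "\<mu> \<noteq> {}"
  obtains \<nu> where "young_less \<nu> \<mu>"
proof -
  obtain i j where "(i, j) \<in> \<mu>" using assms(2) by auto
  then show thesis using ex_corner[OF assms(1)] that by metis
qed

text \<open>Removing a corner other than \<open>c\<close> would leave a lower cover that contains
  \<open>c\<close>; being a lower cover of \<open>\<nu>'\<close> too, it would put \<open>c\<close>
  into \<open>\<nu>'\<close>. So \<open>c\<close> is the only corner, and every cell has a corner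
  weakly beyond it.\<close>

lemma unique_corner_of_same_lower_covers:
  assumes \<nu>: "\<nu> \<in> young_diagrams"
    and same: "\<And>\<mu>. young_less \<mu> \<nu> \<longleftrightarrow> young_less \<mu> \<nu>'"
    and c: "young_less (\<nu> - {c}) \<nu>" "c \<in> \<nu>" "c \<notin> \<nu>'" and x: "x \<in> \<nu>"
  shows "fst x \<le> fst c \<and> snd x \<le> snd c"
proof -
  obtain k l where kl: "(k, l) \<in> \<nu>" "fst x \<le> k" "snd x \<le> l" "young_less (\<nu> - {(k, l)}) \<nu>"
    using ex_corner[OF \<nu>, of "fst x" "snd x"] x by auto
  have "\<nu> - {(k, l)} \<subseteq> \<nu>'" using kl(4) same unfolding young_less_def by blast
  then have "c = (k, l)" using c by blast
  then show ?thesis using kl by simp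
qed

text \<open>The neighbours of the added cells, where they exist, must lie in \<open>\<mu>\<close>.
  The cell left of \<open>(a, b)\<close> forces \<open>b = b' + 1\<close>; a cell above
  \<open>(a, b)\<close> or left of \<open>(a', b')\<close> would violate \<open>below\<close>, so
  \<open>a = 1\<close> and \<open>b' = 1\<close>.\<close>

lemma incomparable_corners_two_cells:
  assumes \<nu>: "\<nu> \<in> young_diagrams" and \<nu>': "\<nu>' \<in> young_diagrams"
    and eq: "\<nu> = insert (a, b) \<mu>" "\<nu>' = insert (a', b') \<mu>"
    and notin: "(a, b) \<notin> \<mu>" "(a', b') \<notin> \<mu>" and lt: "a < a'" "b' < b"
    and below: "\<And>k l. (k, l) \<in> \<mu> \<Longrightarrow> k \<le> a \<and> l \<le> b'"
  shows "\<nu> = {(1, 1), (1, 2)}"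
proof -
  have pos: "1 \<le> a" "1 \<le> b" "1 \<le> a'" "1 \<le> b'"
    using young_pos[OF \<nu>, of a b] young_pos[OF \<nu>', of a' b'] eq by auto
  have "(a, b - 1) \<in> \<mu>" using young_down[OF \<nu>, of a b a "b - 1"] eq pos lt by fastforce
  then have b: "b = b' + 1" using below lt by fastforce
  have a1: "a = 1"
  proof (rule ccontr)
    assume "a \<noteq> 1"
    then have "(a - 1, b) \<in> \<mu>" using young_down[OF \<nu>, of a b "a - 1" b] eq pos by fastforce
    then show False using below lt by fastforce
  qed
  have b1: "b' = 1"
  proof (rule ccontr)
    assume "b' \<noteq> 1"
    then have "(a', b' - 1) \<in> \<mu>" using young_down[OF \<nu>', of a' b' a' "b' - 1"] eq pos by fastforce
    then show False using below lt by fastforce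
  qed
  have "(k, l) \<in> \<mu> \<longleftrightarrow> k = 1 \<and> l = 1" for k l
  proof
    assume "(k, l) \<in> \<mu>"
    then show "k = 1 \<and> l = 1" using below[of k l] young_pos[OF \<nu>, of k l] eq a1 b1 by force
  next
    assume "k = 1 \<and> l = 1"
    then show "(k, l) \<in> \<mu>" using \<open>(a, b - 1) \<in> \<mu>\<close> a1 b b1 by simp
  qed
  then have "\<mu> = {(1, 1)}" by force
  then show ?thesis using eq a1 b b1 by auto
qed

text \<open>The bound on the size is sharp: the two diagrams with two cells have the same lower cover.\<close>

lemma young_eq_if_same_lower_covers:
  assumes \<nu>: "\<nu> \<in> young_diagrams" and \<nu>': "\<nu>' \<in> young_diagrams"
    and card: "3 \<le> card \<nu>"
    and same: "\<And>\<mu>. young_less \<mu> \<nu> \<longleftrightarrow> young_less \<mu> \<nu>'"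
  shows "\<nu> = \<nu>'"
proof (rule ccontr)
  assume ne: "\<nu> \<noteq> \<nu>'"
  have "\<nu> \<noteq> {}" using card by auto
  then obtain \<mu> where less: "young_less \<mu> \<nu>" by (rule ex_lower_cover[OF \<nu>])
  then have less': "young_less \<mu> \<nu>'" using same by simp
  obtain a b where c: "(a, b) \<notin> \<mu>" "\<nu> = insert (a, b) \<mu>"
    using less unfolding young_less_def by auto
  obtain a' b' where c': "(a', b') \<notin> \<mu>" "\<nu>' = insert (a', b') \<mu>"
    using less' unfolding young_less_def by auto
  have diff: "\<nu> - {(a, b)} = \<mu>" "\<nu>' - {(a', b')} = \<mu>" using c c' by auto
  \<comment> \<open>Both diagrams are \<open>\<mu>\<close> with one cell added; as they differ, each
    added cell is missing from the other diagram and is therefore the unique corner of its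
    own.\<close>
  have nin: "(a, b) \<notin> \<nu>'" "(a', b') \<notin> \<nu>" using c c' ne by auto
  have top: "k \<le> a \<and> l \<le> b" if "(k, l) \<in> \<nu>" for k l
    using unique_corner_of_same_lower_covers[OF \<nu> same, of "(a, b)" "(k, l)"] less diff c nin that
    by simp
  have top': "k \<le> a' \<and> l \<le> b'" if "(k, l) \<in> \<nu>'" for k l
    using unique_corner_of_same_lower_covers[OF \<nu>' same[symmetric], of "(a', b')" "(k, l)"]
      less' diff c' nin that by simp
  have pos: "1 \<le> a" "1 \<le> b" "1 \<le> a'" "1 \<le> b'"
    using young_pos[OF \<nu>, of a b] young_pos[OF \<nu>', of a' b'] c c' by auto
  \<comment> \<open>Were the two added cells comparable, downward closure would put the smaller one
    into the other diagram.\<close>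
  have inc: "\<not> (a \<le> a' \<and> b \<le> b')" "\<not> (a' \<le> a \<and> b' \<le> b)"
    using young_down[OF \<nu>', of a' b' a b] young_down[OF \<nu>, of a b a' b'] nin c c' pos by auto
  have below: "k \<le> a \<and> l \<le> b \<and> k \<le> a' \<and> l \<le> b'" if "(k, l) \<in> \<mu>" for k l
    using top[of k l] top'[of k l] c c' that by simp
  consider "a < a'" "b' < b" | "a' < a" "b < b'" using inc by linarith
  then have "\<nu> = {(1, 1), (1, 2)} \<or> \<nu>' = {(1, 1), (1, 2)}"
  proof cases
    case 1
    then show ?thesis
      using incomparable_corners_two_cells[OF \<nu> \<nu>' c(2) c'(2) c(1) c'(1)] below by blast
  next
    case 2
    then show ?thesis
      using incomparable_corners_two_cells[OF \<nu>' \<nu> c'(2) c(2) c'(1) c(1)] below by blast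
  qed
  moreover have "card \<nu>' = card \<nu>" using young_less_card less less' by metis
  ultimately show False using card by auto
qed

section \<open>Diagrams with at most two cells\<close>

lemma young_card_1:
  assumes "\<mu> \<in> young_diagrams" "card \<mu> = 1"
  shows "\<mu> = {(1, 1)}"
proof -
  obtain c where c: "\<mu> = {c}" using assms(2) by (rule card_1_singletonE)
  then show ?thesis using young_one_one[OF assms(1)] by simp
qed

lemma young_card_2:
  assumes \<mu>: "\<mu> \<in> young_diagrams" and card: "card \<mu> = 2"
  shows "\<mu> = {(1, 1), (1, 2)} \<or> \<mu> = {(1, 1), (2, 1)}"
proof -
  have "\<mu> \<noteq> {}" using card by auto
  then obtain \<nu> where less: "young_less \<nu> \<mu>" by (rule ex_lower_cover[OF \<mu>])
  then have "\<nu> = {(1, 1)}"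
    using young_card_1 young_less_card[OF less] card unfolding young_less_def by auto
  then obtain i j where ij: "\<mu> = {(i, j), (1, 1)}" "(i, j) \<noteq> (1, 1)"
    using less unfolding young_less_def by auto
  have pos: "1 \<le> i" "1 \<le> j" using young_pos[OF \<mu>, of i j] ij by auto
  have "i \<le> 2"
  proof (rule ccontr)
    assume "\<not> i \<le> 2"
    then show False using young_down[OF \<mu>, of i j 2 1] ij pos by auto
  qed
  moreover have "j \<le> 2"
  proof (rule ccontr)
    assume "\<not> j \<le> 2"
    then show False using young_down[OF \<mu>, of i j 1 2] ij pos by auto
  qed
  moreover have "\<not> (i = 2 \<and> j = 2)" using young_down[OF \<mu>, of i j 1 2] ij by auto
  ultimately have "(i, j) = (1, 2) \<or> (i, j) = (2, 1)" using pos ij by force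
  then show ?thesis using ij by auto
qed

text \<open>The source of the dichotomy: a size-preserving map can only fix or reflect a diagram
  with two cells.\<close>

lemma young_card_2_reflect:
  assumes "\<mu> \<in> young_diagrams" "card \<mu> = 2" "\<nu> \<in> young_diagrams" "card \<nu> = 2"
  shows "\<nu> = \<mu> \<or> \<nu> = reflect \<mu>"
proof -
  have "reflect {(1, 1), (1, 2)} = {(1, 1), (2, 1)}" "reflect {(1, 1), (2, 1)} = {(1, 1), (1, 2)}"
    by (simp_all add: reflect_def)
  then show ?thesis
    using young_card_2[OF assms(1,2)] young_card_2[OF assms(3,4)] by (elim disjE) simp_all
qed

lemma reflect_card_le_1:
  assumes "\<mu> \<in> young_diagrams" "card \<mu> \<le> 1"
  shows "reflect \<mu> = \<mu>"
proof -
  consider "card \<mu> = 0" | "card \<mu> = 1" using assms(2) by linarith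
  then have "\<mu> = {} \<or> \<mu> = {(1, 1)}"
    using young_card_1[OF assms(1)] young_finite[OF assms(1)] by cases auto
  then show ?thesis by (auto simp: reflect_def)
qed


section \<open>Automorphisms fixing the empty diagram\<close>

text \<open>Only the values of \<open>\<phi>\<close> on \<open>\<Gamma>\<close> are constrained, so
  \<open>inv_into \<Gamma> \<phi>\<close> is again an instance without being restricted.\<close>

locale order_ideal_auto =
  fixes \<Gamma> :: "(nat \<times> nat) set set" and \<phi>
  assumes sub: "\<Gamma> \<subseteq> young_diagrams"
    and closed: "\<And>\<mu> \<nu>. \<nu> \<in> \<Gamma> \<Longrightarrow> young_less \<mu> \<nu> \<Longrightarrow> \<mu> \<in> \<Gamma>"
    and bij: "bij_betw \<phi> \<Gamma> \<Gamma>"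
    and adj: "\<And>\<mu> \<nu>. \<mu> \<in> \<Gamma> \<Longrightarrow> \<nu> \<in> \<Gamma> \<Longrightarrow> young_adj (\<phi> \<mu>) (\<phi> \<nu>) \<longleftrightarrow> young_adj \<mu> \<nu>"
    and empty: "{} \<in> \<Gamma>" and fix_empty: "\<phi> {} = {}"
begin

lemma mem: "\<mu> \<in> \<Gamma> \<Longrightarrow> \<phi> \<mu> \<in> \<Gamma>"
  using bij by (auto simp: bij_betw_def)

lemma young: "\<mu> \<in> \<Gamma> \<Longrightarrow> \<mu> \<in> young_diagrams"
  using sub by blast

text \<open>Sizes change by one along an edge, so a chain of covers from the empty diagram to
  \<open>\<mu>\<close> bounds the size of the image. The opposite inequality comes from the inverse
  automorphism.\<close>

lemma card_image_le: "\<mu> \<in> \<Gamma> \<Longrightarrow> card (\<phi> \<mu>) \<le> card \<mu>"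
proof (induction "card \<mu>" arbitrary: \<mu> rule: less_induct)
  case less
  show ?case
  proof (cases "\<mu> = {}")
    case False
    then obtain \<nu> where \<nu>: "young_less \<nu> \<mu>" using ex_lower_cover young less.prems by blast
    then have G: "\<nu> \<in> \<Gamma>" using closed less.prems by blast
    have "card (\<phi> \<nu>) \<le> card \<nu>" using less.hyps[of \<nu>] G young_less_card[OF \<nu>] by simp
    moreover have "young_adj (\<phi> \<nu>) (\<phi> \<mu>)" using adj G less.prems \<nu> by (simp add: young_adj_def)
    then have "card (\<phi> \<mu>) \<le> Suc (card (\<phi> \<nu>))"
      unfolding young_adj_def using young_less_card by fastforce
    ultimately show ?thesis using young_less_card[OF \<nu>] by simp
  qed (simp add: fix_empty)
qed

lemma inverse: "order_ideal_auto \<Gamma> (inv_into \<Gamma> \<phi>)"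
proof
  show b: "bij_betw (inv_into \<Gamma> \<phi>) \<Gamma> \<Gamma>" using bij by (rule bij_betw_inv_into)
  fix \<mu> \<nu> assume "\<mu> \<in> \<Gamma>" "\<nu> \<in> \<Gamma>"
  then show "young_adj (inv_into \<Gamma> \<phi> \<mu>) (inv_into \<Gamma> \<phi> \<nu>) \<longleftrightarrow> young_adj \<mu> \<nu>"
    using adj[OF bij_betw_apply[OF b] bij_betw_apply[OF b], of \<mu> \<nu>]
    by (simp add: bij_betw_inv_into_right[OF bij])
next
  show "inv_into \<Gamma> \<phi> {} = {}"
    using bij_betw_inv_into_left[OF bij empty] fix_empty by simp
qed (fact sub closed empty)+

lemma card_image: "\<mu> \<in> \<Gamma> \<Longrightarrow> card (\<phi> \<mu>) = card \<mu>"
  using order_ideal_auto.card_image_le[OF inverse, of "\<phi> \<mu>"] card_image_le[of \<mu>] mem[of \<mu>] bij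
  by (simp add: bij_betw_inv_into_left)

lemma less_iff: "\<mu> \<in> \<Gamma> \<Longrightarrow> \<nu> \<in> \<Gamma> \<Longrightarrow> young_less (\<phi> \<mu>) (\<phi> \<nu>) \<longleftrightarrow> young_less \<mu> \<nu>"
  by (simp add: young_less_iff_adj adj card_image)

text \<open>\<open>\<rho>\<close> stands for both candidates at once; each is an involution
  preserving diagrams and covers. By induction on size, \<open>\<phi> \<mu>\<close> and
  \<open>\<rho> \<mu>\<close> have the same lower covers, which determine a diagram with at least
  three cells.\<close>

lemma determined_by_small:
  assumes \<rho>: "\<rho> = (\<lambda>\<mu>. \<mu>) \<or> \<rho> = reflect"
    and small: "\<And>\<mu>. \<mu> \<in> \<Gamma> \<Longrightarrow> card \<mu> \<le> 2 \<Longrightarrow> \<phi> \<mu> = \<rho> \<mu>"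
  shows "\<mu> \<in> \<Gamma> \<Longrightarrow> \<phi> \<mu> = \<rho> \<mu>"
proof (induction "card \<mu>" arbitrary: \<mu> rule: less_induct)
  case less
  have \<rho>Y: "\<rho> \<nu> \<in> young_diagrams" if "\<nu> \<in> young_diagrams" for \<nu>
    using \<rho> that young_reflect by auto
  have \<rho>\<rho>: "\<rho> (\<rho> \<nu>) = \<nu>" for \<nu> using \<rho> by auto
  have \<rho>less: "young_less (\<rho> \<nu>) (\<rho> \<nu>')" if "young_less \<nu> \<nu>'" for \<nu> \<nu>'
    using \<rho> that young_less_reflect by auto
  show ?case
  proof (cases "card \<mu> \<le> 2")
    case False
    have IH: "\<phi> \<nu> = \<rho> \<nu>" if "young_less \<nu> \<mu>" for \<nu>
      using less.hyps less.prems that closed young_less_card by (metis lessI)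
    have "young_less \<nu> (\<phi> \<mu>) \<longleftrightarrow> young_less \<nu> (\<rho> \<mu>)" for \<nu>
    proof
      assume \<nu>: "young_less \<nu> (\<phi> \<mu>)"
      \<comment> \<open>As \<open>\<Gamma>\<close> is an order ideal, a lower cover of
        \<open>\<phi> \<mu>\<close> is a vertex and so has a preimage.\<close>
      then have "\<nu> \<in> \<Gamma>" using closed mem less.prems by blast
      then obtain \<kappa> where \<kappa>: "\<kappa> \<in> \<Gamma>" "\<nu> = \<phi> \<kappa>" using bij by (auto simp: bij_betw_def)
      then have "young_less \<kappa> \<mu>" using less_iff \<nu> less.prems by simp
      then show "young_less \<nu> (\<rho> \<mu>)" using IH \<kappa> \<rho>less by simp
    next
      assume \<nu>: "young_less \<nu> (\<rho> \<mu>)"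
      then have l: "young_less (\<rho> \<nu>) \<mu>" using \<rho>less \<rho>\<rho> by metis
      then have "\<phi> (\<rho> \<nu>) = \<nu>" using IH \<rho>\<rho> by simp
      then show "young_less \<nu> (\<phi> \<mu>)" using less_iff l closed less.prems by metis
    qed
    moreover have "3 \<le> card (\<phi> \<mu>)" using card_image less.prems False by simp
    ultimately show ?thesis
      using young_eq_if_same_lower_covers[of "\<phi> \<mu>" "\<rho> \<mu>"] \<rho>Y young mem less.prems by blast
  qed (use small less.prems in blast)
qed

lemma small_fixed: "\<mu> \<in> \<Gamma> \<Longrightarrow> card \<mu> \<le> 1 \<Longrightarrow> \<phi> \<mu> = \<mu>"
proof -
  assume \<mu>: "\<mu> \<in> \<Gamma>" and "card \<mu> \<le> 1"
  then consider "card \<mu> = 0" | "card \<mu> = 1" by linarith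
  then show "\<phi> \<mu> = \<mu>"
  proof cases
    case 1
    then show ?thesis using young_finite[OF young[OF \<mu>]] fix_empty by simp
  next
    case 2
    then show ?thesis
      using young_card_1[OF young[OF \<mu>]] young_card_1[OF young[OF mem[OF \<mu>]]] card_image[OF \<mu>]
      by simp
  qed
qed

theorem id_or_reflect: "(\<forall>\<mu>\<in>\<Gamma>. \<phi> \<mu> = \<mu>) \<or> (\<forall>\<mu>\<in>\<Gamma>. \<phi> \<mu> = reflect \<mu>)"
proof (cases "\<forall>\<mu>\<in>\<Gamma>. card \<mu> = 2 \<longrightarrow> \<phi> \<mu> = \<mu>")
  case True
  then have "\<phi> \<mu> = \<mu>" if "\<mu> \<in> \<Gamma>" "card \<mu> \<le> 2" for \<mu>
    using that small_fixed by (cases "card \<mu> = 2") auto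
  then show ?thesis using determined_by_small[of "\<lambda>\<mu>. \<mu>"] by blast
next
  case False
  then obtain \<kappa> where \<kappa>: "\<kappa> \<in> \<Gamma>" "card \<kappa> = 2" "\<phi> \<kappa> \<noteq> \<kappa>" by blast
  then have \<phi>\<kappa>: "\<phi> \<kappa> = reflect \<kappa>"
    using young_card_2_reflect[of \<kappa> "\<phi> \<kappa>"] young mem card_image by metis
  have "\<phi> \<mu> = reflect \<mu>" if \<mu>: "\<mu> \<in> \<Gamma>" "card \<mu> \<le> 2" for \<mu>
  proof (cases "card \<mu> = 2")
    case True
    consider "\<mu> = \<kappa>" | "\<mu> \<noteq> \<kappa>" "\<mu> = reflect \<kappa>"
      using young_card_2_reflect[of \<kappa> \<mu>] young \<kappa> \<mu> True by blast
    then show ?thesis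
    proof cases
      case 2
      \<comment> \<open>The value \<open>\<mu>\<close> is already taken at \<open>\<kappa>\<close>,
        so injectivity forbids fixing \<open>\<mu>\<close>.\<close>
      then have "\<phi> \<mu> \<noteq> \<mu>" using \<phi>\<kappa> \<kappa> \<mu> bij by (metis bij_betw_def inj_onD)
      then show ?thesis
        using young_card_2_reflect[of \<mu> "\<phi> \<mu>"] young mem card_image \<mu> True by metis
    qed (simp add: \<phi>\<kappa>)
  next
    case False
    then show ?thesis using small_fixed reflect_card_le_1 young \<mu> by simp
  qed
  then show ?thesis using determined_by_small[of reflect] by blast
qed

end


section \<open>The dihedral symmetry of \<open>YL N\<close>\<close>

text \<open>The largest \<open>i\<close> and \<open>j\<close> are the leg plus one and the arm plus
  one, so their sum is the hook length plus one; hence the bound \<open>N + 1\<close>. For the empty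
  diagram the condition is vacuous.\<close>

lemma YL_iff:
  "\<mu> \<in> YL N \<longleftrightarrow> \<mu> \<in> young_diagrams \<and> (\<forall>i j. (i, 1) \<in> \<mu> \<and> (1, j) \<in> \<mu> \<longrightarrow> i + j \<le> N + 1)"
proof (cases "\<mu> \<in> young_diagrams \<and> \<mu> \<noteq> {}")
  case True
  then have \<mu>: "\<mu> \<in> young_diagrams" and one: "(1, 1) \<in> \<mu>" using young_one_one by auto
  define A where "A = {j. 1 < j \<and> (1, j) \<in> \<mu>}"
  define L where "L = {i. 1 < i \<and> (i, 1) \<in> \<mu>}"
  have fA: "finite A" unfolding A_def
    by (rule finite_subset[OF _ finite_imageI[OF young_finite[OF \<mu>], of snd]]) force
  have fL: "finite L" unfolding L_def
    by (rule finite_subset[OF _ finite_imageI[OF young_finite[OF \<mu>], of fst]]) force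
  have jA: "j \<le> card A + 1" if "(1, j) \<in> \<mu>" for j
  proof -
    have "{2..j} \<subseteq> A" unfolding A_def using young_down[OF \<mu> that] by auto
    from card_mono[OF fA this] show ?thesis by simp
  qed
  have iL: "i \<le> card L + 1" if "(i, 1) \<in> \<mu>" for i
  proof -
    have "{2..i} \<subseteq> L" unfolding L_def using young_down[OF \<mu> that] by auto
    from card_mono[OF fL this] show ?thesis by simp
  qed
  have mA: "(1, card A + 1) \<in> \<mu>"
  proof -
    \<comment> \<open>Inserting \<open>1\<close> makes the maximum meaningful when the arm is
      empty.\<close>
    define m where "m = Max (insert 1 A)"
    have "m \<in> insert 1 A" unfolding m_def using fA by (intro Max_in) auto
    then have "(1, m) \<in> \<mu>" "1 \<le> m" using one by (auto simp: A_def)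
    moreover have "A \<subseteq> {2..m}" using fA by (auto simp: m_def A_def)
    then have "card A + 1 \<le> m" using card_mono[of "{2..m}" A] \<open>1 \<le> m\<close> by simp
    ultimately show ?thesis using young_down[OF \<mu>, of 1 m 1 "card A + 1"] by simp
  qed
  have mL: "(card L + 1, 1) \<in> \<mu>"
  proof -
    define m where "m = Max (insert 1 L)"
    have "m \<in> insert 1 L" unfolding m_def using fL by (intro Max_in) auto
    then have "(m, 1) \<in> \<mu>" "1 \<le> m" using one by (auto simp: L_def)
    moreover have "L \<subseteq> {2..m}" using fL by (auto simp: m_def L_def)
    then have "card L + 1 \<le> m" using card_mono[of "{2..m}" L] \<open>1 \<le> m\<close> by simp
    ultimately show ?thesis using young_down[OF \<mu>, of m 1 "card L + 1" 1] by simp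
  qed
  have "hook_length \<mu> (1, 1) = card A + card L + 1" by (simp add: hook_length_def A_def L_def)
  then have "\<mu> \<in> YL N \<longleftrightarrow> (card L + 1) + (card A + 1) \<le> N + 1"
    using True by (auto simp: YL_def)
  also have "\<dots> \<longleftrightarrow> (\<forall>i j. (i, 1) \<in> \<mu> \<and> (1, j) \<in> \<mu> \<longrightarrow> i + j \<le> N + 1)"
    using jA iL mA mL by (meson add_le_mono le_trans)
  finally show ?thesis using \<mu> by blast
qed (auto simp: YL_def)

lemma YL_young: "\<mu> \<in> YL N \<Longrightarrow> \<mu> \<in> young_diagrams"
  by (simp add: YL_def)

lemma YL_hook: "\<mu> \<in> YL N \<Longrightarrow> (i, 1) \<in> \<mu> \<Longrightarrow> (1, j) \<in> \<mu> \<Longrightarrow> i + j \<le> N + 1"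
  unfolding YL_iff by blast

lemma YL_empty: "{} \<in> YL N"
  by (simp add: YL_def young_empty)

lemma YL_closed: "\<nu> \<in> YL N \<Longrightarrow> young_less \<mu> \<nu> \<Longrightarrow> \<mu> \<in> YL N"
  unfolding YL_iff young_less_def by blast

lemma YL_reflect: "\<mu> \<in> YL N \<Longrightarrow> reflect \<mu> \<in> YL N"
  unfolding YL_iff using young_reflect by (simp add: add.commute) (metis add.commute)

lemma YL_box:
  assumes "\<mu> \<in> YL N" "(i, j) \<in> \<mu>"
  shows "1 \<le> i \<and> i \<le> N \<and> 1 \<le> j \<and> j \<le> N"
proof -
  note Y = YL_young[OF assms(1)]
  have pos: "1 \<le> i" "1 \<le> j" using young_pos[OF Y assms(2)] by auto
  then have "(i, 1) \<in> \<mu>" "(1, j) \<in> \<mu>" "(1, 1) \<in> \<mu>" using young_down[OF Y assms(2)] by auto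
  then show ?thesis using YL_hook[OF assms(1)] pos by fastforce
qed

text \<open>If the first row has length \<open>l\<close>, the condition on \<open>(1, N + 1 - i)\<close> says \<open>i \<le> N - l\<close>, and
  \<open>N - l\<close> is the length of the new first column.\<close>

definition suter :: "nat \<Rightarrow> (nat \<times> nat) set \<Rightarrow> (nat \<times> nat) set" where
  "suter N \<mu> =
    {(i, j). 1 \<le> i \<and> (if j = 1 then i \<le> N \<and> (1, N + 1 - i) \<notin> \<mu> else (i + 1, j - 1) \<in> \<mu>)}"

lemma suter_iff:
  "(i, j) \<in> suter N \<mu> \<longleftrightarrow>
    1 \<le> i \<and> (if j = 1 then i \<le> N \<and> (1, N + 1 - i) \<notin> \<mu> else (i + 1, j - 1) \<in> \<mu>)"
  by (simp add: suter_def)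

section \<open>Suter's symmetry as an automorphism\<close>

lemma YL_suter:
  assumes \<mu>: "\<mu> \<in> YL N"
  shows "suter N \<mu> \<in> YL N"
proof -
  note Y = YL_young[OF \<mu>]
  have box: "1 \<le> i \<and> i \<le> N \<and> 1 \<le> j \<and> j \<le> N + 1" if "(i, j) \<in> suter N \<mu>" for i j
  proof (cases "j = 1")
    case False
    then have "(i + 1, j - 1) \<in> \<mu>" "1 \<le> i" using that by (auto simp: suter_iff)
    then show ?thesis using YL_box[OF \<mu>, of "i + 1" "j - 1"] by auto
  qed (use that in \<open>auto simp: suter_iff\<close>)
  have "suter N \<mu> \<in> young_diagrams"
  proof (rule young_diagramsI)
    have "suter N \<mu> \<subseteq> {1..N} \<times> {1..N + 1}" using box by auto
    then show "finite (suter N \<mu>)" by (rule finite_subset) auto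
  next
    fix i j i' j'
    assume ij: "(i, j) \<in> suter N \<mu>" and le: "1 \<le> i'" "i' \<le> i" "1 \<le> j'" "j' \<le> j"
    have iN: "1 \<le> i" "i \<le> N" using box[OF ij] by auto
    show "(i', j') \<in> suter N \<mu>"
    proof (cases "j' = 1")
      case True
      \<comment> \<open>If \<open>(1, N + 1 - i')\<close> were in \<open>\<mu>\<close>, then for
        \<open>j = 1\<close> the first row would be long enough to exclude \<open>i\<close>;
        otherwise \<open>\<mu>\<close> has at least \<open>i + 1\<close> rows, and the hook bound
        gives \<open>i < i'\<close>.\<close>
      have "(1, N + 1 - i') \<notin> \<mu>"
      proof
        assume *: "(1, N + 1 - i') \<in> \<mu>"
        show False
        proof (cases "j = 1")
          case True
          then have "(1, N + 1 - i) \<notin> \<mu>" using ij by (simp add: suter_iff)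
          moreover have "1 \<le> N + 1 - i" "N + 1 - i \<le> N + 1 - i'" using le iN by auto
          ultimately show False using young_down[OF Y *, of 1 "N + 1 - i"] by blast
        next
          case False
          then have "(i + 1, j - 1) \<in> \<mu>" using ij by (simp add: suter_iff)
          then have "(i + 1, 1) \<in> \<mu>" using young_down[OF Y, of "i + 1" "j - 1" "i + 1" 1] False le
            by simp
          then show False using YL_hook[OF \<mu> _ *] le iN by fastforce
        qed
      qed
      then show ?thesis using True le iN by (simp add: suter_iff)
    next
      case False
      then have "(i + 1, j - 1) \<in> \<mu>" using ij le by (auto simp: suter_iff split: if_splits)
      then have "(i' + 1, j' - 1) \<in> \<mu>"
        using young_down[OF Y, of "i + 1" "j - 1" "i' + 1" "j' - 1"] False le by simp
      then show ?thesis using False le by (simp add: suter_iff)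
    qed
  qed (use box in auto)
  \<comment> \<open>If the old first row has length \<open>l\<close>, the new first column has
    \<open>N - l\<close> cells. The new first row is at most one longer than the old second row, so
    it has at most \<open>l + 1\<close> cells.\<close>
  moreover have "i + j \<le> N + 1" if i: "(i, 1) \<in> suter N \<mu>" and j: "(1, j) \<in> suter N \<mu>" for i j
  proof (cases "j = 1")
    case True
    then show ?thesis using box[OF i] by simp
  next
    case False
    have "(2, j - 1) \<in> \<mu>" using j False by (simp add: suter_iff numeral_2_eq_2)
    moreover have "1 \<le> j - 1" using False box[OF j] by linarith
    ultimately have *: "(1, j - 1) \<in> \<mu>" using young_down[OF Y, of 2 "j - 1" 1 "j - 1"] by simp
    have iN: "i \<le> N" "(1, N + 1 - i) \<notin> \<mu>" using i by (auto simp: suter_iff)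
    have "1 \<le> N + 1 - i" using iN by simp
    then have "\<not> N + 1 - i \<le> j - 1" using young_down[OF Y *, of 1 "N + 1 - i"] iN by blast
    then show ?thesis using iN by linarith
  qed
  ultimately show ?thesis unfolding YL_iff by blast
qed

text \<open>\<open>suter N\<close> followed by \<open>reflect\<close> replaces the first row, of
  length \<open>l\<close>, by one of length \<open>N - l\<close> and transposes the rows below it.
  Done twice, both changes cancel.\<close>

lemma reflect_suter_reflect_suter:
  assumes \<mu>: "\<mu> \<in> YL N"
  shows "reflect (suter N (reflect (suter N \<mu>))) = \<mu>"
proof -
  have "(i, j) \<in> reflect (suter N (reflect (suter N \<mu>))) \<longleftrightarrow> (i, j) \<in> \<mu>" for i j
  proof (cases "i = 1")
    case True
    have "j \<in> {1..N}" if "(1, j) \<in> \<mu>" using YL_box[OF \<mu> that] by simp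
    then show ?thesis using True by (auto simp: suter_iff)
  next
    case False
    have "1 < i \<and> 1 \<le> j" if "(i, j) \<in> \<mu>" using YL_box[OF \<mu> that] False by simp
    moreover have "0 < i" "Suc (i - Suc 0) = i" if "1 < i" using that by auto
    moreover have "(0, k) \<notin> \<mu>" for k using YL_box[OF \<mu>, of 0 k] by auto
    ultimately show ?thesis using False by (cases "i = 0") (auto simp: suter_iff)
  qed
  then show ?thesis by auto
qed

text \<open>With the previous lemma, this makes the conjugate of \<open>suter N\<close> by
  \<open>reflect\<close> its two-sided inverse.\<close>

lemma suter_reflect_suter_reflect:
  assumes "\<mu> \<in> YL N"
  shows "suter N (reflect (suter N (reflect \<mu>))) = \<mu>"
  using reflect_suter_reflect_suter[OF YL_reflect[OF assms]] by (metis reflect_reflect)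

text \<open>A cell added to the first row shortens the new column by one, which reverses the cover;
  any other added cell moves one step up and right, which keeps it. So adjacency survives although
  the order does not.\<close>

lemma suter_adj_if_less:
  assumes \<nu>: "\<nu> \<in> YL N" and less: "young_less \<mu> \<nu>"
  shows "young_adj (suter N \<mu>) (suter N \<nu>)"
proof -
  have \<mu>: "\<mu> \<in> YL N" using YL_closed[OF \<nu> less] .
  note Y = YL_young[OF YL_suter[OF \<mu>]] YL_young[OF YL_suter[OF \<nu>]]
  obtain i j where c: "(i, j) \<notin> \<mu>" "\<nu> = insert (i, j) \<mu>" using less unfolding young_less_def by auto
  have box: "1 \<le> i" "i \<le> N" "1 \<le> j" "j \<le> N" using YL_box[OF \<nu>, of i j] c by auto
  show ?thesis
  proof (cases "i = 1")
    case True
    have "suter N \<mu> = insert (N + 1 - j, 1) (suter N \<nu>)"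
      using c box True by (auto simp: suter_iff split: if_splits)
    moreover have "(N + 1 - j, 1) \<notin> suter N \<nu>" using c box True by (auto simp: suter_iff)
    ultimately show ?thesis unfolding young_adj_def young_less_def using Y by blast
  next
    case False
    have "suter N \<nu> = insert (i - 1, j + 1) (suter N \<mu>)"
      using c box False by (auto simp: suter_iff split: if_splits)
    moreover have "(i - 1, j + 1) \<notin> suter N \<mu>" using c box False by (auto simp: suter_iff)
    ultimately show ?thesis unfolding young_adj_def young_less_def using Y by blast
  qed
qed

lemma suter_adj:
  "\<mu> \<in> YL N \<Longrightarrow> \<nu> \<in> YL N \<Longrightarrow> young_adj \<mu> \<nu> \<Longrightarrow> young_adj (suter N \<mu>) (suter N \<nu>)"
  using suter_adj_if_less young_adj_sym unfolding young_adj_def by blast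

section \<open>Rectangles and vertices with at most one neighbour\<close>

lemma suter_rectangle:
  assumes "k \<le> N"
  shows "suter N ({1..N + 1 - k} \<times> {1..k}) = {1..N - k} \<times> {1..k + 1}"
  using assms by (auto simp: suter_iff split: if_splits)

text \<open>Each corner yields a lower neighbour, so a nonempty \<open>\<mu>\<close> has one corner
  and is a rectangle. A hook shorter than \<open>N\<close> would leave room for a cell under the
  first column, hence a second neighbour. The empty diagram is the case
  \<open>k = 0\<close>.\<close>

lemma unique_neighbour_imp_rectangle:
  assumes \<mu>: "\<mu> \<in> YL N"
    and deg: "\<And>\<nu> \<nu>'. \<nu> \<in> YL N \<Longrightarrow> \<nu>' \<in> YL N \<Longrightarrow> young_adj \<mu> \<nu> \<Longrightarrow> young_adj \<mu> \<nu>' \<Longrightarrow> \<nu> = \<nu>'"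
  shows "\<exists>k\<le>N. \<mu> = {1..N + 1 - k} \<times> {1..k}"
proof (cases "\<mu> = {}")
  case True
  then show ?thesis by (intro exI[of _ 0]) simp
next
  case False
  note Y = YL_young[OF \<mu>]
  have one: "(1, 1) \<in> \<mu>" using young_one_one[OF Y False] .
  define a where "a = (GREATEST i. (i, 1) \<in> \<mu>)"
  define b where "b = (GREATEST j. (1, j) \<in> \<mu>)"
  have a: "(a, 1) \<in> \<mu>" and amax: "\<And>i. (i, 1) \<in> \<mu> \<Longrightarrow> i \<le> a"
    using GreatestI_nat[of "\<lambda>i. (i, 1) \<in> \<mu>" 1 N] Greatest_le_nat[of "\<lambda>i. (i, 1) \<in> \<mu>" _ N]
      YL_box[OF \<mu>] one unfolding a_def by auto
  have b: "(1, b) \<in> \<mu>" and bmax: "\<And>j. (1, j) \<in> \<mu> \<Longrightarrow> j \<le> b"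
    using GreatestI_nat[of "\<lambda>j. (1, j) \<in> \<mu>" 1 N] Greatest_le_nat[of "\<lambda>j. (1, j) \<in> \<mu>" _ N]
      YL_box[OF \<mu>] one unfolding b_def by auto
  have pos: "1 \<le> a" "1 \<le> b" using young_pos[OF Y a] young_pos[OF Y b] by auto
  have below: "1 \<le> i \<and> i \<le> a \<and> 1 \<le> j \<and> j \<le> b" if "(i, j) \<in> \<mu>" for i j
    using young_down[OF Y that, of i 1] young_down[OF Y that, of 1 j] young_pos[OF Y that] amax bmax
    by simp
  obtain k l where kl: "(k, l) \<in> \<mu>" "a \<le> k" "1 \<le> l" "young_less (\<mu> - {(k, l)}) \<mu>"
    using ex_corner[OF Y a] .
  obtain k' l' where kl': "(k', l') \<in> \<mu>" "1 \<le> k'" "b \<le> l'" "young_less (\<mu> - {(k', l')}) \<mu>"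
    using ex_corner[OF Y b] .
  \<comment> \<open>A corner in the last row and one in the last column give the same neighbour, so
    they are the same cell \<open>(a, b)\<close>.\<close>
  have "\<mu> - {(k, l)} = \<mu> - {(k', l')}"
    using deg YL_closed[OF \<mu>] kl(4) kl'(4) unfolding young_adj_def by blast
  then have "(k, l) = (k', l')" using kl(1) kl'(1) by blast
  then have ab: "(a, b) \<in> \<mu>" using below[OF kl(1)] kl kl' by simp
  \<comment> \<open>\<open>a + b - 1\<close> is the hook length of the cell
    \<open>(1, 1)\<close>.\<close>
  have "N \<le> a + b - 1"
  proof (rule ccontr)
    assume *: "\<not> N \<le> a + b - 1"
    define \<nu> where "\<nu> = insert (a + 1, 1) \<mu>"
    have nin: "(a + 1, 1) \<notin> \<mu>" using below[of "a + 1" 1] by auto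
    have \<nu>Y: "\<nu> \<in> young_diagrams"
    proof (rule young_diagramsI)
      show "finite \<nu>" using young_finite[OF Y] by (simp add: \<nu>_def)
    next
      fix i j i' j' assume "(i, j) \<in> \<nu>" and le: "1 \<le> i'" "i' \<le> i" "1 \<le> j'" "j' \<le> j"
      then consider "(i, j) \<in> \<mu>" | "i = a + 1" "j = 1" unfolding \<nu>_def by blast
      then show "(i', j') \<in> \<nu>"
      proof cases
        case 1
        then show ?thesis using young_down[OF Y 1 le] by (simp add: \<nu>_def)
      next
        case 2
        then show ?thesis using young_down[OF Y a, of i' j'] le by (auto simp: \<nu>_def le_Suc_eq)
      qed
    qed (use below in \<open>auto simp: \<nu>_def\<close>)
    moreover have "i + j \<le> N + 1" if "(i, 1) \<in> \<nu>" "(1, j) \<in> \<nu>" for i j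
      using that below[of i 1] below[of 1 j] * pos by (auto simp: \<nu>_def)
    ultimately have "\<nu> \<in> YL N" unfolding YL_iff by blast
    moreover have "young_less \<mu> \<nu>" unfolding young_less_def using Y \<nu>Y nin \<nu>_def by blast
    ultimately have "\<nu> = \<mu> - {(k, l)}"
      using deg YL_closed[OF \<mu> kl(4)] kl(4) unfolding young_adj_def by blast
    then show False using kl(1) \<nu>_def by blast
  qed
  moreover have "a + b \<le> N + 1" using YL_hook[OF \<mu> a b] .
  ultimately have "a = N + 1 - b" "b \<le> N" using pos by auto
  moreover have "(i, j) \<in> \<mu> \<longleftrightarrow> (i, j) \<in> {1..a} \<times> {1..b}" for i j
    using below[of i j] young_down[OF Y ab, of i j] by auto
  then have "\<mu> = {1..a} \<times> {1..b}" by auto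
  ultimately show ?thesis by blast
qed


section \<open>Recognising dihedral groups\<close>

context group
begin

text \<open>Moving \<open>f\<close> past one factor \<open>r\<close> inverts it. The induction is
  done for an arbitrary pair \<open>x\<close>, \<open>y\<close>, so that it serves \<open>r\<close>
  and \<open>inv r\<close> alike and thus both signs of the exponent.\<close>

lemma involution_int_pow:
  assumes r: "r \<in> carrier G" and f: "f \<in> carrier G" and ff: "f \<otimes> f = \<one>"
    and fr: "f \<otimes> r = inv r \<otimes> f"
  shows "f \<otimes> r [^] (b::int) = r [^] (- b) \<otimes> f"
proof -
  have nat: "f \<otimes> x [^] n = y [^] n \<otimes> f"
    if "x \<in> carrier G" "y \<in> carrier G" "f \<otimes> x = y \<otimes> f" for x y and n :: nat
  proof (induction n)
    case (Suc n)
    have "f \<otimes> x [^] Suc n = (f \<otimes> x [^] n) \<otimes> x" using that f by (simp add: m_assoc)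
    also have "\<dots> = y [^] n \<otimes> (f \<otimes> x)" using that f Suc by (simp add: m_assoc)
    also have "\<dots> = y [^] Suc n \<otimes> f" using that f by (simp add: m_assoc)
    finally show ?case .
  qed (use f in simp)
  have fr': "f \<otimes> inv r = r \<otimes> f"
  proof -
    have "f \<otimes> inv r = f \<otimes> (inv r \<otimes> f) \<otimes> f" using r f ff by (simp add: m_assoc)
    also have "\<dots> = (f \<otimes> f) \<otimes> r \<otimes> f" using r f fr by (simp add: m_assoc)
    finally show ?thesis using r ff by simp
  qed
  show ?thesis
  proof (cases b rule: int_cases2)
    case (nonneg n)
    then show ?thesis
      using nat[OF r _ fr, of n] r by (simp add: int_pow_int int_pow_neg_int nat_pow_inv)
  next
    case (nonpos n)
    then show ?thesis
      using nat[OF _ r fr', of n] r by (simp add: int_pow_int int_pow_neg_int nat_pow_inv)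
  qed
qed

text \<open>The relations make the normal forms multiply like the pairs of
  \<open>dihedral_group n\<close>; bijectivity says that \<open>r\<close> and \<open>f\<close>
  generate the group and that no two normal forms coincide.\<close>

lemma iso_dihedral_group:
  assumes r: "r \<in> carrier G" and f: "f \<in> carrier G"
    and rn: "r [^] n = \<one>" and ff: "f \<otimes> f = \<one>" and frfr: "f \<otimes> r \<otimes> f \<otimes> r = \<one>"
    and bij: "bij_betw (\<lambda>(a, s). r [^] (a::int) \<otimes> (if s then f else \<one>)) ({0..<int n} \<times> UNIV) (carrier G)"
  shows "G \<cong> dihedral_group n"
proof -
  let ?h = "\<lambda>(a, s). r [^] (a::int) \<otimes> (if s then f else \<one>)"
  have fr: "f \<otimes> r = inv r \<otimes> f"
  proof -
    have "(f \<otimes> r) \<otimes> (f \<otimes> r) = \<one>" using frfr r f by (simp add: m_assoc)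
    then have "f \<otimes> r = inv (f \<otimes> r)" using r f by (metis inv_equality m_closed)
    also have "\<dots> = inv r \<otimes> inv f" using r f by (simp add: inv_mult_group)
    also have "inv f = f" using ff f by (simp add: inv_equality)
    finally show ?thesis .
  qed
  note frb = involution_int_pow[OF r f ff fr]
  \<comment> \<open>This matches the reduction \<open>mod\<close> in the multiplication of
    \<open>dihedral_group\<close>.\<close>
  have md: "r [^] (a mod int n) = r [^] a" for a :: int
  proof -
    have "r [^] a = r [^] (int n * (a div int n) + a mod int n)" by simp
    also have "\<dots> = (r [^] int n) [^] (a div int n) \<otimes> r [^] (a mod int n)"
      using r by (simp only: int_pow_mult int_pow_pow)
    also have "\<dots> = r [^] (a mod int n)" using r rn by (simp add: int_pow_int)
    finally show ?thesis by simp
  qed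
  have hm: "?h (x \<otimes>\<^bsub>dihedral_group n\<^esub> y) = ?h x \<otimes> ?h y" for x y
  proof -
    obtain a s b t where xy: "x = (a, s)" "y = (b, t)" by fastforce
    have "r [^] a \<otimes> f \<otimes> r [^] b = r [^] (a - b) \<otimes> f"
    proof -
      have "r [^] a \<otimes> f \<otimes> r [^] b = r [^] a \<otimes> (r [^] (- b) \<otimes> f)"
        using r f frb[of b] by (simp add: m_assoc)
      also have "\<dots> = r [^] (a + - b) \<otimes> f"
        using r f int_pow_mult[OF r, of a "- b"] by (simp only: m_assoc int_pow_closed)
      finally show ?thesis by simp
    qed
    moreover from this have "r [^] a \<otimes> f \<otimes> r [^] b \<otimes> f = r [^] (a - b)"
      using r f ff by (simp add: m_assoc)
    ultimately show ?thesis
      using r f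
      by (cases s; cases t)
        (simp_all add: xy dihedral_group_def md int_pow_mult m_assoc[symmetric])
  qed
  have "?h \<in> hom (dihedral_group n) G"
  proof (rule homI)
    show "?h x \<in> carrier G" if "x \<in> carrier (dihedral_group n)" for x
      using r f by (cases x) simp
  qed (rule hm)
  then have "?h \<in> iso (dihedral_group n) G"
    using bij by (simp add: iso_def dihedral_group_def)
  then have "dihedral_group n \<cong> G" by (auto simp: is_iso_def)
  \<comment> \<open>For \<open>n = 0\<close> the domain of the bijection would be empty. Positivity
    makes \<open>dihedral_group n\<close> a group, which allows the isomorphism to be
    reversed.\<close>
  moreover have "n \<ge> 1"
  proof (rule ccontr)
    assume "\<not> n \<ge> 1"
    then show False using bij one_closed by (auto simp: bij_betw_def)
  qed
  ultimately show ?thesis using group.iso_sym[OF group_dihedral_group] by blast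
qed

end

section \<open>The automorphism group of \<open>YL N\<close>\<close>

lemma YL_auto:
  assumes "\<phi> \<in> graph_automorphisms (YL N) young_adj" "\<phi> {} = {}"
  shows "order_ideal_auto (YL N) \<phi>"
proof
  show "YL N \<subseteq> young_diagrams" using YL_young by blast
  show "bij_betw \<phi> (YL N) (YL N)" using assms(1) by (simp add: graph_automorphisms_def Bij_def)
  show "young_adj (\<phi> \<mu>) (\<phi> \<nu>) \<longleftrightarrow> young_adj \<mu> \<nu>" if "\<mu> \<in> YL N" "\<nu> \<in> YL N" for \<mu> \<nu>
    using assms(1) that by (simp add: graph_automorphisms_def)
qed (fact YL_closed YL_empty assms(2))+

text \<open>Both maps need to preserve adjacency only forwards: the converse for \<open>g\<close> is
  the property of \<open>h\<close> at the images.\<close>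

lemma graph_automorphismsI:
  assumes g: "\<And>x. x \<in> V \<Longrightarrow> g x \<in> V" and h: "\<And>x. x \<in> V \<Longrightarrow> h x \<in> V"
    and hg: "\<And>x. x \<in> V \<Longrightarrow> h (g x) = x" and gh: "\<And>x. x \<in> V \<Longrightarrow> g (h x) = x"
    and gadj: "\<And>x y. x \<in> V \<Longrightarrow> y \<in> V \<Longrightarrow> adj x y \<Longrightarrow> adj (g x) (g y)"
    and hadj: "\<And>x y. x \<in> V \<Longrightarrow> y \<in> V \<Longrightarrow> adj x y \<Longrightarrow> adj (h x) (h y)"
  shows "restrict g V \<in> graph_automorphisms V adj"
proof -
  have "bij_betw g V V" by (rule bij_betw_byWitness[of _ h]) (use assms in auto)
  then have "restrict g V \<in> Bij V" by (auto simp: Bij_def bij_betw_restrict_eq)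
  moreover have "adj (g x) (g y) \<longleftrightarrow> adj x y" if "x \<in> V" "y \<in> V" for x y
    using gadj[OF that] hadj[OF g[OF that(1)] g[OF that(2)]] hg that by auto
  ultimately show ?thesis by (simp add: graph_automorphisms_def)
qed

theorem Aut_YL_dihedral:
  assumes N: "N \<ge> 2"
  shows "Aut_graph (YL N) young_adj \<cong> dihedral_group (N + 1)"
proof -
  define V where "V = YL N"
  define A where "A = Aut_graph V young_adj"
  define r where "r = restrict (suter N) V"
  define f where "f = restrict reflect V"
  interpret A: group A unfolding A_def by (rule group_Aut_graph)
  have carr: "carrier A = graph_automorphisms V young_adj" by (simp add: A_def Aut_graph_def)
  have carrB: "\<phi> \<in> Bij V" if "\<phi> \<in> carrier A" for \<phi>
    using that carr by (simp add: graph_automorphisms_def)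
  have mem: "\<phi> \<mu> \<in> V" if "\<phi> \<in> carrier A" "\<mu> \<in> V" for \<phi> \<mu>
    using carrB[OF that(1)] that(2) by (auto simp: Bij_def bij_betw_def)
  have mult: "(\<phi> \<otimes>\<^bsub>A\<^esub> \<psi>) \<mu> = \<phi> (\<psi> \<mu>)" if "\<phi> \<in> carrier A" "\<psi> \<in> carrier A" "\<mu> \<in> V" for \<phi> \<psi> \<mu>
    using carrB[OF that(1)] carrB[OF that(2)] that(3)
    by (simp add: A_def Aut_graph_def BijGroup_def compose_eq)
  have one: "\<one>\<^bsub>A\<^esub> \<mu> = \<mu>" if "\<mu> \<in> V" for \<mu>
    using that by (simp add: A_def Aut_graph_def BijGroup_def)
  have ext: "\<phi> = \<psi>" if "\<phi> \<in> carrier A" "\<psi> \<in> carrier A" "\<And>\<mu>. \<mu> \<in> V \<Longrightarrow> \<phi> \<mu> = \<psi> \<mu>" for \<phi> \<psi>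
    using extensionalityI[of \<phi> V \<psi>] carrB[OF that(1)] carrB[OF that(2)] that(3)
    by (simp add: Bij_def)
  have e: "{} \<in> V" by (simp add: V_def YL_empty)
  have fC: "f \<in> carrier A" unfolding carr f_def V_def
    by (rule graph_automorphismsI[of _ _ reflect]) (simp_all add: YL_reflect young_adj_reflect)
  have rC: "r \<in> carrier A" unfolding carr r_def V_def
    by (rule graph_automorphismsI[of _ _ "\<lambda>\<mu>. reflect (suter N (reflect \<mu>))"])
      (simp_all add: YL_reflect YL_suter reflect_suter_reflect_suter suter_reflect_suter_reflect
        suter_adj young_adj_reflect)
  have fV: "f \<mu> = reflect \<mu>" "reflect \<mu> \<in> V" and rV: "r \<mu> = suter N \<mu>" "suter N \<mu> \<in> V"
    if "\<mu> \<in> V" for \<mu>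
    using that by (simp_all add: f_def r_def V_def YL_reflect YL_suter)
  have ff: "f \<otimes>\<^bsub>A\<^esub> f = \<one>\<^bsub>A\<^esub>"
    by (rule ext) (simp_all add: fC mult one fV)
  have frfr: "f \<otimes>\<^bsub>A\<^esub> r \<otimes>\<^bsub>A\<^esub> f \<otimes>\<^bsub>A\<^esub> r = \<one>\<^bsub>A\<^esub>"
    by (rule ext) (simp_all add: fC rC mult one fV rV reflect_suter_reflect_suter[of _ N, folded V_def])
  have id_or_f: "\<phi> = \<one>\<^bsub>A\<^esub> \<or> \<phi> = f" if \<phi>: "\<phi> \<in> carrier A" "\<phi> {} = {}" for \<phi>
  proof -
    have "(\<forall>\<mu>\<in>V. \<phi> \<mu> = \<mu>) \<or> (\<forall>\<mu>\<in>V. \<phi> \<mu> = reflect \<mu>)"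
      using order_ideal_auto.id_or_reflect[OF YL_auto] \<phi> unfolding carr V_def by blast
    then show ?thesis using ext[OF \<phi>(1) A.one_closed] ext[OF \<phi>(1) fC] one fV by metis
  qed
  have rect: "(r [^]\<^bsub>A\<^esub> k) {} = {1..N + 1 - k} \<times> {1..k}" if "k \<le> N + 1" for k :: nat
    using that
  proof (induction k)
    case 0
    then show ?case by (simp add: one e)
  next
    case (Suc k)
    have "r [^]\<^bsub>A\<^esub> Suc k = r \<otimes>\<^bsub>A\<^esub> r [^]\<^bsub>A\<^esub> k" using A.nat_pow_Suc2[OF rC] .
    then have "(r [^]\<^bsub>A\<^esub> Suc k) {} = suter N ((r [^]\<^bsub>A\<^esub> k) {})"
      using mult[OF rC _ e] rV mem e rC by simp
    also have "\<dots> = {1..N + 1 - Suc k} \<times> {1..Suc k}"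
      using Suc suter_rectangle[of k N] by simp
    finally show ?case .
  qed
  \<comment> \<open>The number of columns is read off in row 1, which exists for \<open>k\<close>
    and \<open>l\<close> up to \<open>N\<close>; at \<open>N + 1\<close> the rectangle is empty
    again, as at \<open>0\<close>.\<close>
  have rect_inj: "k = l" if "{1..N + 1 - k} \<times> {1..k} = {1..N + 1 - l} \<times> {1..l}" "k \<le> N" "l \<le> N"
    for k l :: nat
  proof -
    have "i \<le> k \<longleftrightarrow> i \<le> l" if "1 \<le> i" for i
    proof -
      have "(1, i) \<in> {1..N + 1 - k} \<times> {1..k} \<longleftrightarrow> (1, i) \<in> {1..N + 1 - l} \<times> {1..l}"
        using \<open>{1..N + 1 - k} \<times> {1..k} = _\<close> by simp
      moreover have "1 \<le> N + 1 - k" "1 \<le> N + 1 - l" using \<open>k \<le> N\<close> \<open>l \<le> N\<close> by linarith+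
      ultimately show ?thesis using that by simp
    qed
    from this[of k] this[of l] show ?thesis by (cases "k = 0"; cases "l = 0") auto
  qed
  have f1: "f \<noteq> \<one>\<^bsub>A\<^esub>"
  proof
    assume f1: "f = \<one>\<^bsub>A\<^esub>"
    \<comment> \<open>The column of \<open>N\<close> cells is a vertex that \<open>f\<close> moves,
      since \<open>N \<ge> 2\<close>.\<close>
    have "(r [^]\<^bsub>A\<^esub> (1::nat)) {} = {1..N} \<times> {1..1}" using rect[of 1] N by simp
    then have V1: "{1..N} \<times> {1..1} \<in> V" using mem[OF A.nat_pow_closed[OF rC] e] by metis
    then have "reflect ({1..N} \<times> {1..1}) = {1..N} \<times> {1..1}" using f1 fV(1) one by metis
    then have "(2, 1) \<in> {1..N} \<times> {1..1::nat} \<longleftrightarrow> (1, 2) \<in> {1..N} \<times> {1..1::nat}"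
      by (metis reflect_iff)
    then show False using N by simp
  qed
  have rn: "r [^]\<^bsub>A\<^esub> (N + 1) = \<one>\<^bsub>A\<^esub>"
  proof (rule ccontr)
    assume "r [^]\<^bsub>A\<^esub> (N + 1) \<noteq> \<one>\<^bsub>A\<^esub>"
    moreover have "(r [^]\<^bsub>A\<^esub> (N + 1)) {} = {}" using rect[of "N + 1"] by simp
    ultimately have rf: "r [^]\<^bsub>A\<^esub> (N + 1) = f"
      using id_or_f[OF A.nat_pow_closed[OF rC]] by blast
    have "f \<otimes>\<^bsub>A\<^esub> r = r \<otimes>\<^bsub>A\<^esub> f"
      unfolding rf[symmetric] using A.nat_pow_Suc2[OF rC, of "N + 1"] by simp
    then have "\<one>\<^bsub>A\<^esub> = r \<otimes>\<^bsub>A\<^esub> (f \<otimes>\<^bsub>A\<^esub> f) \<otimes>\<^bsub>A\<^esub> r"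
      using frfr rC fC by (simp add: A.m_assoc)
    then have "r [^]\<^bsub>A\<^esub> (2::nat) = \<one>\<^bsub>A\<^esub>"
      using ff rC by (simp add: numeral_2_eq_2)
    \<comment> \<open>\<open>r\<close> squared sends the empty diagram to \<open>N - 1\<close> rows
      of two cells, which is nonempty for \<open>N \<ge> 2\<close>.\<close>
    then have "{1..N + 1 - 2} \<times> {1..2::nat} = {}" using rect[of 2] one[OF e] N by simp
    then show False using N by auto
  qed
  let ?h = "\<lambda>(a, s). r [^]\<^bsub>A\<^esub> (a::int) \<otimes>\<^bsub>A\<^esub> (if s then f else \<one>\<^bsub>A\<^esub>)"
  \<comment> \<open>As \<open>f\<close> fixes the empty diagram, the image of the latter depends on
    the exponent of \<open>r\<close> alone and determines it.\<close>
  have h_empty: "(r [^]\<^bsub>A\<^esub> (k::nat) \<otimes>\<^bsub>A\<^esub> (if s then f else \<one>\<^bsub>A\<^esub>)) {} = {1..N + 1 - k} \<times> {1..k}"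
    if "k \<le> N" for k s
    using mult[OF A.nat_pow_closed[OF rC] _ e] fC one[OF e] fV(1)[OF e] rect that by simp
  have "bij_betw ?h ({0..<int (N + 1)} \<times> UNIV) (carrier A)"
    unfolding bij_betw_def
  proof
    show "inj_on ?h ({0..<int (N + 1)} \<times> UNIV)"
    proof (rule inj_onI, clarify)
      fix a b :: int and s t
      assume ab: "a \<in> {0..<int (N + 1)}" "b \<in> {0..<int (N + 1)}"
        and eq: "r [^]\<^bsub>A\<^esub> a \<otimes>\<^bsub>A\<^esub> (if s then f else \<one>\<^bsub>A\<^esub>)
          = r [^]\<^bsub>A\<^esub> b \<otimes>\<^bsub>A\<^esub> (if t then f else \<one>\<^bsub>A\<^esub>)"
      obtain k l where kl: "a = int k" "b = int l" "k \<le> N" "l \<le> N"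
        using ab that[of "nat a" "nat b"] by auto
      have "k = l" using rect_inj h_empty[of k s] h_empty[of l t] eq kl by (simp add: int_pow_int)
      moreover from this have "(if s then f else \<one>\<^bsub>A\<^esub>) = (if t then f else \<one>\<^bsub>A\<^esub>)"
        using eq kl fC rC by (simp split: if_splits)
      then have "s = t" using f1 by (simp split: if_splits)
      ultimately show "a = b \<and> s = t" using kl by simp
    qed
    show "?h ` ({0..<int (N + 1)} \<times> UNIV) = carrier A"
    proof (intro equalityI subsetI)
      fix \<phi> assume \<phi>: "\<phi> \<in> carrier A"
      have adj: "young_adj (\<phi> \<mu>) (\<phi> \<nu>) \<longleftrightarrow> young_adj \<mu> \<nu>" if "\<mu> \<in> V" "\<nu> \<in> V" for \<mu> \<nu>
        using \<phi> that carr by (simp add: graph_automorphisms_def)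
      have "\<exists>k\<le>N. \<phi> {} = {1..N + 1 - k} \<times> {1..k}"
      proof (rule unique_neighbour_imp_rectangle)
        show "\<phi> {} \<in> YL N" using mem[OF \<phi> e] by (simp add: V_def)
      next
        fix \<nu> \<nu>' assume \<nu>: "\<nu> \<in> YL N" "\<nu>' \<in> YL N" "young_adj (\<phi> {}) \<nu>" "young_adj (\<phi> {}) \<nu>'"
        have "\<phi> ` V = V" using carrB[OF \<phi>] by (simp add: Bij_def bij_betw_def)
        then have "\<nu> \<in> \<phi> ` V" "\<nu>' \<in> \<phi> ` V" using \<nu>(1,2) by (simp_all add: V_def)
        then obtain \<kappa> \<kappa>' where \<kappa>: "\<kappa> \<in> V" "\<nu> = \<phi> \<kappa>" "\<kappa>' \<in> V" "\<nu>' = \<phi> \<kappa>'" by blast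
        \<comment> \<open>The empty diagram has just one possible neighbour, and
          \<open>\<phi>\<close> transports this property to \<open>\<phi> {}\<close>.\<close>
        have "\<xi> = {(1, 1)}" if "young_adj {} \<xi>" for \<xi>
          using that young_card_1[of \<xi>] young_less_card[of "{}" \<xi>]
          unfolding young_adj_def young_less_def by auto
        moreover have "young_adj {} \<kappa>" "young_adj {} \<kappa>'"
          using \<kappa> \<nu>(3,4) adj[OF e] by simp_all
        ultimately show "\<nu> = \<nu>'" using \<kappa> by metis
      qed
      then obtain k where k: "k \<le> N" "\<phi> {} = (r [^]\<^bsub>A\<^esub> k) {}" using rect by auto
      define \<rho> where "\<rho> = r [^]\<^bsub>A\<^esub> k"
      have \<rho>: "\<rho> \<in> carrier A" using rC by (simp add: \<rho>_def)
      \<comment> \<open>Undoing the power of \<open>r\<close> with the same effect on the empty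
        diagram leaves an element of the stabiliser.\<close>
      define \<psi> where "\<psi> = inv\<^bsub>A\<^esub> \<rho> \<otimes>\<^bsub>A\<^esub> \<phi>"
      have \<psi>: "\<psi> \<in> carrier A" using \<phi> \<rho> by (simp add: \<psi>_def)
      have "\<psi> {} = (inv\<^bsub>A\<^esub> \<rho>) (\<rho> {})" using mult[OF _ \<phi> e] \<rho> k by (simp add: \<psi>_def \<rho>_def)
      also have "\<dots> = {}" using mult[OF A.inv_closed[OF \<rho>] \<rho> e] \<rho> one[OF e] by simp
      finally have "\<psi> = \<one>\<^bsub>A\<^esub> \<or> \<psi> = f" using id_or_f[OF \<psi>] by simp
      then obtain s where "\<psi> = (if s then f else \<one>\<^bsub>A\<^esub>)" by metis
      moreover have "\<phi> = \<rho> \<otimes>\<^bsub>A\<^esub> \<psi>" using \<phi> \<rho> by (simp add: \<psi>_def A.m_assoc[symmetric])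
      ultimately have "\<phi> = ?h (int k, s)" by (simp add: \<rho>_def int_pow_int)
      then show "\<phi> \<in> ?h ` ({0..<int (N + 1)} \<times> UNIV)" 
        using k(1) by (intro image_eqI[of _ _ "(int k, s)"]) simp_all
    qed (use rC fC in auto)
  qed
  then show ?thesis
    using A.iso_dihedral_group[OF rC fC rn ff frfr] unfolding A_def V_def by blast
qed

text \<open>Fixing the empty diagram presupposes that it is a vertex, hence
  \<open>{} \<in> \<Gamma>\<close>. The bound on \<open>N\<close> excludes the case refuted in
  \<open>not_iso_YL_1\<close>.\<close>

theorem proposition9p6:
  shows "(\<forall>\<Gamma> \<phi>. \<Gamma> \<subseteq> young_diagrams \<and>
            (\<forall>\<nu>\<in>\<Gamma>. \<forall>\<mu>. young_less \<mu> \<nu> \<longrightarrow> \<mu> \<in> \<Gamma>) \<and>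
            \<phi> \<in> carrier (Aut_graph \<Gamma> young_adj) \<and> {} \<in> \<Gamma> \<and> \<phi> {} = {} \<longrightarrow>
            (\<forall>\<mu>\<in>\<Gamma>. \<phi> \<mu> = \<mu>) \<or> (\<forall>\<mu>\<in>\<Gamma>. \<phi> \<mu> = reflect \<mu>)) \<and>
         (\<forall>N\<ge>2. Aut_graph (YL N) young_adj \<cong> dihedral_group (N + 1))"
proof (intro conjI allI impI)
  fix \<Gamma> and \<phi> :: "(nat \<times> nat) set \<Rightarrow> (nat \<times> nat) set"
  assume "\<Gamma> \<subseteq> young_diagrams \<and> (\<forall>\<nu>\<in>\<Gamma>. \<forall>\<mu>. young_less \<mu> \<nu> \<longrightarrow> \<mu> \<in> \<Gamma>) \<and>
    \<phi> \<in> carrier (Aut_graph \<Gamma> young_adj) \<and> {} \<in> \<Gamma> \<and> \<phi> {} = {}"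
  then have "order_ideal_auto \<Gamma> \<phi>"
    unfolding order_ideal_auto_def by (simp add: Aut_graph_def graph_automorphisms_def Bij_def)
  then show "(\<forall>\<mu>\<in>\<Gamma>. \<phi> \<mu> = \<mu>) \<or> (\<forall>\<mu>\<in>\<Gamma>. \<phi> \<mu> = reflect \<mu>)"
    by (rule order_ideal_auto.id_or_reflect)
qed (rule Aut_YL_dihedral)

end
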